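(* Let $C\subset\mathbb{R}^n$ be a pointed closed convex cone with nonempty interior and let $p,q\in\mathbb{R}$. Let $\{u_1,u_2,\dots,u_m\}\subset\Omega_{C^\circ}$, and let $\mathbb{P}_1,\mathbb{P}_2\in\mathscr{K}(C,\{u_1,u_2,\dots,u_m\})$ be two $C$-polytopes. Suppose that $\widetilde{C}_{p,q}(\mathbb{P}_1,\cdot)=\widetilde{C}_{p,q}(\mathbb{P}_2,\cdot)$ on $\Omega_{C^\circ}$. Then $\mathbb{P}_1$ and $\mathbb{P}_2$ are dilates of each other if $p=q$, while $\mathbb{P}_1=\mathbb{P}_2$ if $p<q$.
   Context: A pointed closed convex cone $C\subset\mathbb{R}^n$ is a closed convex set with $C=\{\lambda x:\lambda\ge 0,\ x\in C\}$, nonempty interior, and $C\cap(-C)=\{o\}$, where $o$ is the origin. Its polar cone is $C^\circ=\{x\in\mathbb{R}^n: x\cdot y\le 0\text{ for all }y\in C\}$. Put $\Omega_C=S^{n-1}\cap\operatorname{int}C$ and $\Omega_{C^\circ}=S^{n-1}\cap\operatorname{int}C^\circ$. For $u\in S^{n-1}$, $a\in\mathbb{R}$, let $H(u,a)=\{x: x\cdot u=a\}$ and $H^-(u,a)=\{x: x\cdot u\le a\}$. An unbounded closed convex set $\mathbb{A}\subset C$ with $o\notin\mathbb{A}$ is $C$-compatible if $\mathbb{A}$ equals the intersection of $C$ with all half-spaces $H^-(u,a)$, $u\in\Omega_{C^\circ}$, $a\in\mathbb{R}$, that contain $\mathbb{A}$. For a $C$-compatible set $\mathbb{A}$: the support function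 is $h_C(\mathbb{A},u)=\sup\{x\cdot u:x\in\mathbb{A}\}\in(-\infty,0)$, $u\in\Omega_{C^\circ}$; the radial function is $\rho_C(\mathbb{A},v)=\sup\{r>0: rv\in C\setminus\mathbb{A}\}$, for $v\in\Omega_C$ (the same formula is used for $v\in C\cap S^{n-1}$). For a compact set $\omega\subset\Omega_{C^\circ}$, $\mathscr{K}(C,\omega)$ is the family of $C$-compatible sets $\mathbb{A}$ with $\mathbb{A}=C\cap\bigcap_{u\in\omega}H^-(u,h_C(\mathbb{A},u))$. A $C$-polytope is a member of $\mathscr{K}(C,\omega)$ for some finite set $\omega\subset\Omega_{C^\circ}$. Two sets are dilates of each other if one equals $\lambda$ times the other for some $\lambda>0$. Let $\partial_e\mathbb{A}=\partial\mathbb{A}\cap\partial(C\setminus\mathbb{A})$ and $\Omega_C^e=\{x/|x|:x\in\partial_e\mathbb{A}\}\supseteq\Omega_C$ (the difference has spherical Lebesgue measure zero). For $\eta\subseteq\Omega_{C^\circ}$, the reverse radial Gauss image is $\boldsymbol{\alpha}^*_{\mathbb{A}}(\eta)=\{v\in\Omega_C^e:\rho_C(\mathbb{A},v)v\in H(u,h_C(\mathbb{A},u))\text{ for some }u\in\eta\}$. With $dv$ the spherical Lebesgue measure, for Borel $\eta\subseteq\Omega_{C^\circ}$, $\widetilde{C}_q(\mathbb{A},\eta)=\frac1n\int_{\boldsymbol{\alpha}^*_{\mathbb{A}}(\eta)}\rho_C(\mathbb{A},v)^q\,dv$ if $q\ne0$, $\widetilde{C}_0(\mathbb{A},\eta)=\int_{\boldsymbol{\alpha}^*_{\mathbb{A}}(\eta)}dv$,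 and the $(p,q)$-th dual curvature measure is $\widetilde{C}_{p,q}(\mathbb{A},\eta)=\int_\eta(-h_C(\mathbb{A},u))^{-p}\,d\widetilde{C}_q(\mathbb{A},u)$. *)

theory Defs
  imports "HOL-Analysis.Analysis"
begin

definition pointed_closed_convex_cone :: "'a::euclidean_space set \<Rightarrow> bool" where
  "pointed_closed_convex_cone C \<longleftrightarrow>
     closed C \<and> convex C \<and> cone C \<and> interior C \<noteq> {} \<and> C \<inter> uminus ` C = {0}"

definition polar_cone :: "'a::euclidean_space set \<Rightarrow> 'a set" where
  "polar_cone C = {x. \<forall>y\<in>C. x \<bullet> y \<le> 0}"

text \<open>\<open>\<Omega>\<^sub>C\<close> is \<open>open_sector C\<close>, and \<open>\<Omega>\<close> of the polar cone is \<open>open_sector (polar_cone C)\<close>.\<close>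

definition open_sector :: "'a::euclidean_space set \<Rightarrow> 'a set" where
  "open_sector C = sphere 0 1 \<inter> interior C"

definition hyperplane :: "'a::euclidean_space \<Rightarrow> real \<Rightarrow> 'a set" where
  "hyperplane u a = {x. x \<bullet> u = a}"

definition halfspace :: "'a::euclidean_space \<Rightarrow> real \<Rightarrow> 'a set" where
  "halfspace u a = {x. x \<bullet> u \<le> a}"

definition C_compatible :: "'a::euclidean_space set \<Rightarrow> 'a set \<Rightarrow> bool" where
  "C_compatible C A \<longleftrightarrow>
     \<not> bounded A \<and> closed A \<and> convex A \<and> A \<subseteq> C \<and> 0 \<notin> A \<and>
     A = C \<inter> \<Inter>{halfspace u a | u a. u \<in> open_sector (polar_cone C) \<and> A \<subseteq> halfspace u a}"

text \<open>
  The suprema in the next two definitions are taken in the reals. For a \<open>C\<close>-compatible set \<open>A\<close>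
  the first is over a nonempty set bounded above by \<open>0\<close> if \<open>u\<close> lies in the polar cone, and the second
  is over a nonempty bounded set if \<open>v \<in> effective_directions C A\<close> (defined below), the only
  directions at which the radial function is used. (It may be infinite at other boundary
  directions of \<open>C\<close>.) The support function does not depend on \<open>C\<close>; only its domain does.
\<close>

definition support_fun :: "'a::euclidean_space set \<Rightarrow> 'a \<Rightarrow> real" where
  "support_fun A u = (SUP x\<in>A. x \<bullet> u)"

definition radial_fun :: "'a::euclidean_space set \<Rightarrow> 'a set \<Rightarrow> 'a \<Rightarrow> real" where
  "radial_fun C A v = Sup {r. r > 0 \<and> r *\<^sub>R v \<in> C - A}"

definition K_family :: "'a::euclidean_space set \<Rightarrow> 'a set \<Rightarrow> 'a set set" where
  "K_family C \<omega> = {A. C_compatible C A \<and> A = C \<inter> (\<Inter>u\<in>\<omega>. halfspace u (support_fun A u))}"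

definition C_polytope :: "'a::euclidean_space set \<Rightarrow> 'a set \<Rightarrow> bool" where
  "C_polytope C A \<longleftrightarrow>
     (\<exists>\<omega>. finite \<omega> \<and> \<omega> \<subseteq> open_sector (polar_cone C) \<and> A \<in> K_family C \<omega>)"

definition dilates :: "'a::euclidean_space set \<Rightarrow> 'a set \<Rightarrow> bool" where
  "dilates A B \<longleftrightarrow> (\<exists>c>0. A = (\<lambda>x. c *\<^sub>R x) ` B)"

text \<open>
  Surface measure of \<open>B \<subseteq> S\<^sup>n\<^sup>-\<^sup>1\<close> is \<open>n\<close> times the volume of \<open>{r v | 0 < r < 1, v \<in> B}\<close>
  (polar coordinates). The completion is needed because the reverse radial Gauss image of a Borel
  set need not be Borel.
\<close>

definition spherical_lebesgue :: "'a::euclidean_space measure" where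
  "spherical_lebesgue = completion (scale_measure (of_nat DIM('a))
     (distr (restrict_space lborel (ball 0 1 - {0})) (restrict_space borel (sphere 0 1))
        (\<lambda>x. x /\<^sub>R norm x)))"

definition effective_boundary :: "'a::euclidean_space set \<Rightarrow> 'a set \<Rightarrow> 'a set" where
  "effective_boundary C A = frontier A \<inter> frontier (C - A)"

definition effective_directions :: "'a::euclidean_space set \<Rightarrow> 'a set \<Rightarrow> 'a set" where
  "effective_directions C A = (\<lambda>x. x /\<^sub>R norm x) ` effective_boundary C A"

definition reverse_radial_gauss_image ::
    "'a::euclidean_space set \<Rightarrow> 'a set \<Rightarrow> 'a set \<Rightarrow> 'a set" where
  "reverse_radial_gauss_image C A \<eta> =
     {v \<in> effective_directions C A.
        \<exists>u\<in>\<eta>. radial_fun C A v *\<^sub>R v \<in> hyperplane u (support_fun A u)}"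

definition dual_curvature_q ::
    "real \<Rightarrow> 'a::euclidean_space set \<Rightarrow> 'a set \<Rightarrow> 'a set \<Rightarrow> ennreal" where
  "dual_curvature_q q C A \<eta> =
     (if q \<noteq> 0
      then ennreal (1 / real DIM('a)) *
             (\<integral>\<^sup>+v\<in>reverse_radial_gauss_image C A \<eta>. ennreal (radial_fun C A v powr q)
                \<partial>spherical_lebesgue)
      else (\<integral>\<^sup>+v\<in>reverse_radial_gauss_image C A \<eta>. 1 \<partial>spherical_lebesgue))"

text \<open>
  \<open>measure_of\<close> would yield the null measure if the set function were not countably additive. It is
  countably additive: disjoint sets \<open>\<eta>\<close> have reverse radial Gauss images meeting in a null set.
\<close>

definition dual_curvature_q_measure ::
    "real \<Rightarrow> 'a::euclidean_space set \<Rightarrow> 'a set \<Rightarrow> 'a measure" where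
  "dual_curvature_q_measure q C A =
     measure_of (open_sector (polar_cone C)) (sets (restrict_space borel (open_sector (polar_cone C))))
       (dual_curvature_q q C A)"

definition dual_curvature_pq ::
    "real \<Rightarrow> real \<Rightarrow> 'a::euclidean_space set \<Rightarrow> 'a set \<Rightarrow> 'a set \<Rightarrow> ennreal" where
  "dual_curvature_pq p q C A \<eta> =
     (\<integral>\<^sup>+u\<in>\<eta>. ennreal ((- support_fun A u) powr (- p)) \<partial>dual_curvature_q_measure q C A)"

end

theory Submission imports Defs begin

text \<open>
  For a polytope \<open>P\<close> in the family, write \<open>a u = - support_fun P u\<close> for \<open>u \<in> U\<close>. In the cone the radial
  function is \<open>\<rho> v = max\<^sub>u (a u / - (v \<bullet> u))\<close>, and the curvature measure is concentrated on \<open>U\<close>, with mass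
  proportional to \<open>a u powr (q - p) * (\<integral>v\<in>\<Delta> u. (- (v \<bullet> u)) powr (- q))\<close> at \<open>u\<close>, where \<open>\<Delta> u\<close> is the cell of
  directions in which \<open>u\<close> attains the maximum. The normals \<open>u\<close> of positive mass are the same
  for both polytopes, and they determine the polytopes.

  Let \<open>c\<close> be the largest ratio \<open>a u / b u\<close> of the data of the two polytopes over these normals.
  At a maximizing \<open>u\<close> the cell of the first polytope contains that of the second. If \<open>p < q\<close>,
  comparing masses yields \<open>c \<le> 1\<close>, and by symmetry \<open>a = b\<close>. If \<open>p = q\<close>, the cells at the maximizing
  normals agree up to null sets. If some normal were not maximizing, the union of the first
  polytope's cells at the maximizing normals would contain a neighbourhood (in the interior of
  the cone) of the corresponding union for the second; as the interior of the cone is connected,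
  the two unions would differ by a set containing a nonempty open cone, which is not null.
\<close>

section \<open>Spherical Lebesgue measure\<close>

lemma space_spherical_lebesgue:
  "space (spherical_lebesgue :: 'a::euclidean_space measure) = sphere 0 1"
  by (simp add: spherical_lebesgue_def space_scale_measure)

lemma measurable_spherical_lebesgue:
  assumes "f \<in> measurable borel N"
  shows "f \<in> measurable (spherical_lebesgue :: 'a::euclidean_space measure) N"
proof -
  let ?M = "scale_measure (of_nat DIM('a))
     (distr (restrict_space lborel (ball 0 1 - {0})) (restrict_space borel (sphere 0 1))
        (\<lambda>x::'a. x /\<^sub>R norm x))"
  have "f \<in> measurable ?M N"
    using measurable_restrict_space1[OF assms, of "sphere 0 1"]
    by (subst measurable_cong_sets[of _ "restrict_space borel (sphere 0 1)"]) auto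
  then show ?thesis
    unfolding spherical_lebesgue_def by (rule measurable_completion)
qed

lemma normalize_measurable:
  "(\<lambda>x::'a::euclidean_space. x /\<^sub>R norm x)
     \<in> measurable (restrict_space lborel (ball 0 1 - {0})) (restrict_space borel (sphere 0 1))"
proof (rule measurable_restrict_space2)
  show "(\<lambda>x::'a. x /\<^sub>R norm x) \<in> space (restrict_space lborel (ball 0 1 - {0})) \<rightarrow> sphere 0 1"
    by (auto simp: space_restrict_space)
  show "(\<lambda>x::'a. x /\<^sub>R norm x) \<in> borel_measurable (restrict_space lborel (ball 0 1 - {0}))"
    by (intro measurable_restrict_space1) measurable
qed

lemma spherical_lebesgue_finite:
  "emeasure (spherical_lebesgue :: 'a::euclidean_space measure) (sphere 0 1) < \<infinity>"
proof -
  let ?D = "distr (restrict_space lborel (ball 0 1 - {0})) (restrict_space borel (sphere 0 1))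
        (\<lambda>x::'a. x /\<^sub>R norm x)"
  let ?M = "scale_measure (of_nat DIM('a)) ?D"
  have sp: "sphere (0::'a) 1 \<in> sets ?M"
    by (auto simp: sets_restrict_space intro!: image_eqI[where x = "sphere 0 1"])
  have "emeasure spherical_lebesgue (sphere (0::'a) 1) = emeasure ?M (sphere 0 1)"
    unfolding spherical_lebesgue_def using sp by simp
  also have "\<dots> = of_nat DIM('a) * emeasure ?D (sphere 0 1)"
    by simp
  also have "emeasure ?D (sphere 0 1) \<le> emeasure lborel (ball (0::'a) 1)"
    using sp by (subst emeasure_distr[OF normalize_measurable])
      (auto simp: emeasure_restrict_space space_restrict_space intro!: emeasure_mono)
  finally show ?thesis
    using emeasure_lborel_ball_finite[of "0::'a" 1]
    by (metis ennreal_mult_less_top infinity_ennreal_def mult_left_mono of_nat_less_top order_le_less_trans zero_le)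
qed

text \<open>Up to a constant and completion, the spherical measure is the image of volume under
  radial projection, and the preimage of a conic set is that set itself. Null sets of directions can
  thus be tested in space.\<close>

lemma AE_spherical_lebesgue_conic_iff:
  fixes B :: "'a::euclidean_space set"
  assumes B: "B \<in> sets borel" and con: "\<And>r x. r > 0 \<Longrightarrow> x \<in> B \<Longrightarrow> r *\<^sub>R x \<in> B"
  shows "(AE v in spherical_lebesgue. v \<notin> B) \<longleftrightarrow> (B - {0}) \<inter> ball 0 1 \<in> null_sets lborel"
proof -
  let ?L = "restrict_space lborel (ball (0::'a) 1 - {0})"
  let ?D = "distr ?L (restrict_space borel (sphere 0 1)) (\<lambda>x::'a. x /\<^sub>R norm x)"
  \<comment> \<open>Scaling by the nonzero dimension leaves the null sets unchanged.\<close>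
  have ae_scale: "(AE v in scale_measure (of_nat DIM('a)) ?D. v \<notin> B) \<longleftrightarrow> (AE v in ?D. v \<notin> B)"
  proof -
    have "null_sets (scale_measure (of_nat DIM('a)) ?D) = null_sets ?D"
      by (auto simp: null_sets_def)
    then show ?thesis
      by (simp add: eventually_ae_filter space_scale_measure)
  qed
  have *: "x /\<^sub>R norm x \<in> B \<longleftrightarrow> x \<in> B" if "x \<noteq> 0" for x
  proof
    assume "x /\<^sub>R norm x \<in> B"
    then have "norm x *\<^sub>R (x /\<^sub>R norm x) \<in> B" using that by (intro con[OF _ \<open>x /\<^sub>R norm x \<in> B\<close>]) simp
    then show "x \<in> B" using that by simp
  next
    assume "x \<in> B"
    then show "x /\<^sub>R norm x \<in> B" using that by (intro con[OF _ \<open>x \<in> B\<close>]) simp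
  qed
  have "(AE v in spherical_lebesgue. v \<notin> B) \<longleftrightarrow> (AE v in ?D. v \<notin> B)"
    unfolding spherical_lebesgue_def AE_completion_iff ae_scale ..
  also have "\<dots> \<longleftrightarrow> (AE x in ?L. x /\<^sub>R norm x \<notin> B)"
  proof (rule AE_distr_iff[OF normalize_measurable])
    have "{x \<in> space (restrict_space borel (sphere 0 1)). x \<notin> B} = sphere 0 1 \<inter> - B"
      by (auto simp: space_restrict_space)
    also have "\<dots> \<in> sets (restrict_space borel (sphere 0 1))"
      unfolding sets_restrict_space using B by (intro imageI) simp
    finally show "{x \<in> space (restrict_space borel (sphere 0 1)). x \<notin> B} \<in> sets (restrict_space borel (sphere 0 1))" .
  qed
  also have "\<dots> \<longleftrightarrow> (AE x in lborel. x \<in> ball 0 1 - {0} \<longrightarrow> x /\<^sub>R norm x \<notin> B)"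
    by (subst AE_restrict_space_iff) auto
  also have "\<dots> \<longleftrightarrow> (AE x in lborel. x \<notin> (B - {0}) \<inter> ball 0 1)"
    using * by (intro AE_cong) auto
  also have "\<dots> \<longleftrightarrow> (B - {0}) \<inter> ball 0 1 \<in> null_sets lborel"
    using B by (subst AE_iff_null_sets) auto
  finally show ?thesis .
qed

lemma AE_spherical_lebesgue_not_in:
  fixes B :: "'a::euclidean_space set"
  assumes "B \<in> sets borel" and "\<And>r x. r > 0 \<Longrightarrow> x \<in> B \<Longrightarrow> r *\<^sub>R x \<in> B" and "negligible B"
  shows "AE v in spherical_lebesgue. v \<notin> B"
proof (subst AE_spherical_lebesgue_conic_iff)
  have "negligible ((B - {0}) \<inter> ball 0 1)"
    by (rule negligible_subset[OF assms(3)]) auto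
  moreover have "(B - {0}) \<inter> ball 0 1 \<in> sets lborel"
    using assms(1) by auto
  ultimately show "(B - {0}) \<inter> ball 0 1 \<in> null_sets lborel"
    by (simp add: negligible_iff_null_sets null_sets_completion_iff)
qed (rule assms(1), rule assms(2))

text \<open>A nonempty open set contains a nonzero point, and scaling that point into the unit ball
  shows that the part of \<open>B\<close> in the punctured ball is open and nonempty, hence of
  positive volume.\<close>

lemma not_AE_spherical_lebesgue_open:
  fixes B :: "'a::euclidean_space set"
  assumes op: "open B" and con: "\<And>r x. r > 0 \<Longrightarrow> x \<in> B \<Longrightarrow> r *\<^sub>R x \<in> B" and "B \<noteq> {}"
  shows "\<not> (AE v in spherical_lebesgue. v \<notin> B)"
proof
  let ?G = "(B - {0}) \<inter> ball 0 1"
  assume "AE v in spherical_lebesgue. v \<notin> B"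
  then have "?G \<in> null_sets lborel"
    by (subst (asm) AE_spherical_lebesgue_conic_iff[OF borel_open[OF op] con])
  then have "negligible ?G"
    by (simp add: negligible_iff_null_sets null_sets_completionI)
  moreover have "open ?G"
    using op by auto
  moreover have "?G \<noteq> {}"
  proof -
    obtain x where x: "x \<in> B" "x \<noteq> 0"
      using op \<open>B \<noteq> {}\<close> not_open_singleton[of "0::'a"] by (metis ex_in_conv insert_iff subsetI subset_singletonD)
    then have "(1 / (2 * norm x)) *\<^sub>R x \<in> ?G"
      using con[OF _ x(1), of "1 / (2 * norm x)"] by simp
    then show ?thesis by blast
  qed
  ultimately show False
    using open_not_negligible by blast
qed

section \<open>Cells of the interior of the cone\<close>

lemma cone_interior_scaleR:
  fixes C :: "'a::real_normed_vector set"
  assumes "cone C" "x \<in> interior C" "r > 0"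
  shows "r *\<^sub>R x \<in> interior C"
proof -
  have "r *\<^sub>R x \<in> (\<lambda>x. r *\<^sub>R x) ` interior C"
    using assms by auto
  also have "\<dots> \<subseteq> interior C"
  proof (rule interior_maximal)
    show "(\<lambda>x. r *\<^sub>R x) ` interior C \<subseteq> C"
      using assms interior_subset[of C] by (auto simp: cone_def)
    show "open ((\<lambda>x. r *\<^sub>R x) ` interior C)"
      using assms by (intro open_scaling) auto
  qed
  finally show ?thesis .
qed

text \<open>A ball of some radius \<open>e\<close> around \<open>u\<close> lies in the polar cone;
  shifting \<open>u\<close> by \<open>e\<close> in the direction of \<open>x\<close> gives the bound
  with \<open>\<delta> = e\<close>. It keeps \<open>- (x \<bullet> u)\<close> uniformly away from
  zero on the unit vectors of \<open>C\<close>.\<close>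

lemma interior_polar_cone_bound:
  fixes C :: "'a::euclidean_space set"
  assumes "u \<in> interior (polar_cone C)"
  shows "\<exists>\<delta>>0. \<forall>x\<in>C. x \<bullet> u \<le> - (\<delta> * norm x)"
proof -
  obtain e where e: "e > 0" "cball u e \<subseteq> polar_cone C"
    using assms mem_interior_cball by blast
  have "x \<bullet> u \<le> - (e * norm x)" if "x \<in> C" for x
  proof (cases "x = 0")
    case False
    have "u + (e / norm x) *\<^sub>R x \<in> cball u e"
      using e by (simp add: dist_norm False)
    then have "(u + (e / norm x) *\<^sub>R x) \<bullet> x \<le> 0"
      using e that unfolding polar_cone_def by blast
    moreover have "(u + (e / norm x) *\<^sub>R x) \<bullet> x = x \<bullet> u + e * norm x"
      using False by (simp add: inner_add_left inner_commute[of u x] power2_norm_eq_inner[symmetric] power2_eq_square)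
    ultimately show ?thesis by simp
  qed auto
  with e show ?thesis by auto
qed

text \<open>On the cone all inner products \<open>x \<bullet> u\<close> are negative, so the inequality says that \<open>u\<close> attains
  the maximum \<open>a w / - (x \<bullet> w)\<close> over \<open>w \<in> U\<close>.\<close>

definition cell :: "'a::euclidean_space set \<Rightarrow> 'a set \<Rightarrow> ('a \<Rightarrow> real) \<Rightarrow> 'a \<Rightarrow> 'a set" where
  "cell C U a u = {x \<in> interior C. \<forall>w\<in>U. a u * (x \<bullet> w) \<le> a w * (x \<bullet> u)}"

text \<open>In the cell of \<open>u\<close> the radial function is
  \<open>a u / - (v \<bullet> u)\<close>. This integral is what remains of its \<open>q\<close>-th
  power once \<open>a u powr q\<close> is taken out, so the dependence on \<open>a\<close> sits in
  the domain \<open>D\<close> alone.\<close>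

definition cell_mass :: "'a::euclidean_space set \<Rightarrow> real \<Rightarrow> 'a \<Rightarrow> ennreal" where
  "cell_mass D q u =
     (\<integral>\<^sup>+v. ennreal ((- (v \<bullet> u)) powr (- q)) * indicator D v \<partial>spherical_lebesgue)"

section \<open>Signs of inner products with the normals, and elementary properties of cells\<close>

locale cone_normals =
  fixes C :: "'a::euclidean_space set" and U :: "'a set"
  assumes pointed: "pointed_closed_convex_cone C"
    and finite_U: "finite U"
    and U_subset: "U \<subseteq> open_sector (polar_cone C)"
begin

lemma cone_C: "cone C" and closed_C: "closed C" and convex_C: "convex C"
  and interior_C: "interior C \<noteq> {}"
  using pointed by (auto simp: pointed_closed_convex_cone_def)

lemma norm_U: "u \<in> U \<Longrightarrow> norm u = 1"
  using U_subset by (auto simp: open_sector_def)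

lemma inner_bound: "u \<in> U \<Longrightarrow> \<exists>\<delta>>0. \<forall>x\<in>C. x \<bullet> u \<le> - (\<delta> * norm x)"
  using U_subset by (intro interior_polar_cone_bound) (auto simp: open_sector_def)

lemma inner_neg:
  assumes "u \<in> U" "x \<in> C" "x \<noteq> 0"
  shows "x \<bullet> u < 0"
proof -
  obtain \<delta> where d: "\<delta> > 0" "x \<bullet> u \<le> - (\<delta> * norm x)"
    using inner_bound assms by blast
  have "\<delta> * norm x > 0" using d assms by simp
  with d show ?thesis by linarith
qed

text \<open>Otherwise a small positive multiple of \<open>u\<close> would lie in the cone, although
  its inner product with \<open>u\<close> is positive.\<close>

lemma zero_notin_interior:
  assumes "u \<in> U"
  shows "0 \<notin> interior C"
proof
  assume "0 \<in> interior C"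
  then obtain e where e: "e > 0" "cball 0 e \<subseteq> C"
    using mem_interior_cball by blast
  have u0: "u \<noteq> 0" using norm_U[OF assms] by auto
  have "e *\<^sub>R u \<in> C" using e norm_U[OF assms] by (auto simp: subset_iff)
  then show False using inner_neg[OF assms, of "e *\<^sub>R u"] u0 e
    by (simp add: mult_less_0_iff) (metis inner_ge_zero not_less)
qed

lemma inner_neg_interior:
  assumes "u \<in> U" "x \<in> interior C"
  shows "x \<bullet> u < 0"
  using assms inner_neg interior_subset zero_notin_interior by blast

lemma cell_scaleR: "r > 0 \<Longrightarrow> x \<in> cell C V a u \<Longrightarrow> r *\<^sub>R x \<in> cell C V a u"
  by (auto simp: cell_def cone_interior_scaleR[OF cone_C] mult.left_commute)

lemma cell_subset: "cell C V a u \<subseteq> interior C"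
  by (auto simp: cell_def)

lemma cell_eq_Int: "cell C V a u = interior C \<inter> (\<Inter>w\<in>V. {x. a u * (x \<bullet> w) \<le> a w * (x \<bullet> u)})"
  by (auto simp: cell_def)

lemma closed_cell_constraints: "closed (\<Inter>w\<in>V. {x::'a. a u * (x \<bullet> w) \<le> a w * (x \<bullet> u)})"
  by (intro closed_INT ballI closed_Collect_le continuous_intros)

lemma cell_borel: "cell C V a u \<in> sets borel"
  unfolding cell_eq_Int using closed_cell_constraints by (intro sets.Int borel_open[OF open_interior] borel_closed) auto

text \<open>Each cell is the trace on the open set \<open>interior C\<close> of a closed polyhedral
  cone.\<close>

lemma open_minus_cells:
  assumes "finite W"
  shows "open (interior C - (\<Union>u\<in>W. cell C V a u))"
proof -
  have "interior C - (\<Union>u\<in>W. cell C V a u) =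
      interior C - (\<Union>u\<in>W. \<Inter>w\<in>V. {x. a u * (x \<bullet> w) \<le> a w * (x \<bullet> u)})"
    by (auto simp: cell_eq_Int)
  also have "open \<dots>"
    using assms closed_cell_constraints by (intro open_Diff closed_UN) auto
  finally show ?thesis .
qed

lemma minus_cells_scaleR:
  assumes "r > 0" "x \<in> interior C - (\<Union>u\<in>W. cell C V a u)"
  shows "r *\<^sub>R x \<in> interior C - (\<Union>u\<in>W. cell C V a u)"
proof -
  have "x \<in> cell C V a u" if "r *\<^sub>R x \<in> cell C V a u" for u
    using cell_scaleR[OF _ that, of "1 / r"] assms by simp
  then show ?thesis
    using assms cone_interior_scaleR[OF cone_C] by auto
qed

text \<open>Since \<open>V\<close> is finite, some normal attains the maximum of
  \<open>a w / - (x \<bullet> w)\<close>.\<close>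

lemma cells_cover:
  assumes "V \<subseteq> U" "V \<noteq> {}" "x \<in> interior C"
  shows "\<exists>u\<in>V. x \<in> cell C V a u"
proof -
  define f where "f w = a w / (- (x \<bullet> w))" for w
  have fV: "finite V" using assms finite_U finite_subset by auto
  have "Max (f ` V) \<in> f ` V" using fV assms(2) by (intro Max_in) auto
  then obtain u where u: "u \<in> V" "f u = Max (f ` V)" by auto
  have "a u * (x \<bullet> w) \<le> a w * (x \<bullet> u)" if "w \<in> V" for w
  proof -
    define r s where "r = - (x \<bullet> u)" and "s = - (x \<bullet> w)"
    have pos: "r > 0" "s > 0"
      using inner_neg_interior[of w x] inner_neg_interior[of u x] assms u(1) that
      by (auto simp: r_def s_def)
    have "f w \<le> f u" using u(2) fV that by simp
    then have "a w / s \<le> a u / r" by (simp only: f_def r_def s_def)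
    then have "a w * r \<le> a u * s" using pos by (simp add: field_simps)
    then show ?thesis by (simp add: r_def s_def)
  qed
  then show ?thesis using u(1) assms by (auto simp: cell_def)
qed

section \<open>Finiteness, vanishing and comparison of cell masses\<close>

lemma integrand_measurable:
  assumes "D \<in> sets borel"
  shows "(\<lambda>v. ennreal ((- (v \<bullet> u)) powr (- q)) * indicator D v) \<in> borel_measurable (spherical_lebesgue::'a measure)"
  using assms by (intro measurable_spherical_lebesgue borel_measurable_times_ennreal borel_measurable_indicator) auto

text \<open>On unit vectors of the cone \<open>- (v \<bullet> u)\<close> lies between
  \<open>\<delta>\<close> and 1, so the integrand is bounded whatever the sign of \<open>q\<close>.
  Finiteness allows masses to be cancelled and treated as reals.\<close>

lemma cell_mass_finite:
  assumes "u \<in> U" "D \<subseteq> interior C"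
  shows "cell_mass D q u < \<infinity>"
proof -
  obtain \<delta> where d: "\<delta> > 0" "\<And>x. x \<in> C \<Longrightarrow> x \<bullet> u \<le> - (\<delta> * norm x)"
    using inner_bound assms by blast
  \<comment> \<open>The summand \<open>\<delta> powr (- q)\<close> serves \<open>q \<ge> 0\<close>,
    the summand 1 serves \<open>q < 0\<close>.\<close>
  define B where "B = 1 + \<delta> powr (- q)"
  have "cell_mass D q u \<le> (\<integral>\<^sup>+v. ennreal B * indicator (sphere 0 1) v \<partial>(spherical_lebesgue::'a measure))"
    unfolding cell_mass_def
  proof (rule nn_integral_mono)
    fix v :: 'a assume "v \<in> space spherical_lebesgue"
    then have v: "norm v = 1" by (simp add: space_spherical_lebesgue)
    show "ennreal ((- (v \<bullet> u)) powr (- q)) * indicator D v \<le> ennreal B * indicator (sphere 0 1) v"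
    proof (cases "v \<in> D")
      case True
      then have t: "\<delta> \<le> - (v \<bullet> u)"
        using d(2)[of v] v assms interior_subset[of C] by fastforce
      have t1: "- (v \<bullet> u) \<le> 1"
        using Cauchy_Schwarz_ineq2[of v u] v norm_U[OF assms(1)] by auto
      have "(- (v \<bullet> u)) powr (- q) \<le> B"
      proof (cases "q \<ge> 0")
        case True
        have "(- (v \<bullet> u)) powr (- q) \<le> \<delta> powr (-q)"
          using True t d by (intro powr_mono2') auto
        then show ?thesis by (simp add: B_def)
      next
        case False
        have "(- (v \<bullet> u)) powr (- q) \<le> 1 powr (-q)"
          using False t t1 d by (intro powr_mono2) auto
        then show ?thesis by (simp add: B_def add_increasing2)
      qed
      then show ?thesis using v True by (simp add: ennreal_leI)
    qed simp
  qed
  also have "\<dots> = ennreal B * emeasure (spherical_lebesgue::'a measure) (sphere 0 1)"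
    by (rule nn_integral_cmult_indicator)
       (metis sets.top space_spherical_lebesgue)
  also have "\<dots> < \<infinity>"
    using spherical_lebesgue_finite[where 'a = 'a] by (simp add: ennreal_mult_less_top)
  finally show ?thesis .
qed

text \<open>The weight is strictly positive on the interior of the cone.\<close>

lemma cell_mass_eq_0_iff:
  assumes "u \<in> U" "D \<subseteq> interior C" "D \<in> sets borel"
  shows "cell_mass D q u = 0 \<longleftrightarrow> (AE v in spherical_lebesgue. v \<notin> D)"
proof -
  have "cell_mass D q u = 0 \<longleftrightarrow>
      (AE v in spherical_lebesgue. ennreal ((- (v \<bullet> u)) powr (- q)) * indicator D v = 0)"
    unfolding cell_mass_def by (rule nn_integral_0_iff_AE[OF integrand_measurable[OF assms(3)]])
  also have "\<dots> \<longleftrightarrow> (AE v in spherical_lebesgue. v \<notin> D)"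
    using assms inner_neg_interior[of u]
    by (intro AE_cong) (fastforce simp: indicator_def subset_iff)
  finally show ?thesis .
qed

lemma cell_mass_mono: "D \<subseteq> E \<Longrightarrow> cell_mass D q u \<le> cell_mass E q u"
  unfolding cell_mass_def
  by (intro nn_integral_mono mult_left_mono) (auto simp: indicator_def)

text \<open>The mass of \<open>E\<close> splits over \<open>D\<close> and \<open>E - D\<close>;
  cancelling the finite mass of \<open>D\<close> leaves mass zero for the difference.\<close>

lemma AE_subset_if_cell_mass_eq:
  assumes "u \<in> U" "D \<subseteq> E" "E \<subseteq> interior C" "D \<in> sets borel" "E \<in> sets borel"
    and "cell_mass D q u = cell_mass E q u"
  shows "AE v in spherical_lebesgue. v \<notin> E - D"
proof -
  have "cell_mass E q u = (\<integral>\<^sup>+v. ennreal ((- (v \<bullet> u)) powr (- q)) * indicator D v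
      + ennreal ((- (v \<bullet> u)) powr (- q)) * indicator (E - D) v \<partial>spherical_lebesgue)"
    unfolding cell_mass_def using assms(2) by (intro nn_integral_cong) (auto simp: indicator_def)
  also have "\<dots> = cell_mass D q u + cell_mass (E - D) q u"
    unfolding cell_mass_def using assms(4,5)
    by (intro nn_integral_add[OF integrand_measurable integrand_measurable] sets.Diff)
  finally have "cell_mass (E - D) q u = 0"
    using ennreal_add_left_cancel[of "cell_mass D q u" "cell_mass (E - D) q u" 0]
      assms(6) cell_mass_finite[OF assms(1,3), of q] by auto
  then show ?thesis
    using assms by (subst (asm) cell_mass_eq_0_iff) auto
qed

end

section \<open>Radial function and Gauss image of a polytope\<close>

locale cone_polytope = cone_normals C U for C U :: "'a::euclidean_space set" +
  fixes P :: "'a set"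
  assumes P_in: "P \<in> K_family C U"
begin

text \<open>The sign makes the value positive for normals in \<open>U\<close>; as these are unit
  vectors, it is the distance from the origin to the supporting hyperplane.\<close>

definition depth :: "'a \<Rightarrow> real" where "depth u = - support_fun P u"

lemma compatible: "C_compatible C P"
  using P_in by (simp add: K_family_def)

lemma P_subset: "P \<subseteq> C" and closed_P: "closed P" and zero_notin_P: "0 \<notin> P" and P_nonempty: "P \<noteq> {}"
  using compatible by (auto simp: C_compatible_def)

lemma P_eq: "P = {x \<in> C. \<forall>u\<in>U. x \<bullet> u \<le> - depth u}"
proof -
  have "P = C \<inter> (\<Inter>u\<in>U. halfspace u (support_fun P u))"
    using P_in by (simp add: K_family_def)
  also have "\<dots> = {x \<in> C. \<forall>u\<in>U. x \<bullet> u \<le> - depth u}"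
    by (auto simp: halfspace_def depth_def)
  finally show ?thesis .
qed

lemma U_nonempty: "U \<noteq> {}"
proof
  assume "U = {}"
  then have "P = C" using P_eq by simp
  moreover have "0 \<in> C" using cone_contains_0[OF cone_C] interior_C interior_subset[of C] by auto
  ultimately show False using zero_notin_P by simp
qed

lemma le_support_fun:
  assumes "w \<in> open_sector (polar_cone C)" "x \<in> P"
  shows "x \<bullet> w \<le> support_fun P w"
  unfolding support_fun_def
proof (rule cSUP_upper[OF assms(2)])
  have "w \<in> polar_cone C"
    using assms(1) interior_subset by (auto simp: open_sector_def)
  then show "bdd_above ((\<lambda>x. x \<bullet> w) ` P)"
    using P_subset by (intro bdd_aboveI[of _ 0]) (auto simp: polar_cone_def inner_commute)
qed

text \<open>The closed set \<open>P\<close> stays at some distance \<open>r\<close> from the origin,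
  and the linear bound on the cone turns this into
  \<open>support_fun P u \<le> - (\<delta> * r)\<close>.\<close>

lemma dst_pos:
  assumes "u \<in> U"
  shows "depth u > 0"
proof -
  obtain \<delta> where d: "\<delta> > 0" "\<forall>x\<in>C. x \<bullet> u \<le> - (\<delta> * norm x)"
    using inner_bound assms by blast
  obtain r where r: "r > 0" "\<And>x. x \<in> P \<Longrightarrow> r \<le> norm x"
    using separate_point_closed[OF closed_P zero_notin_P] by (auto simp: dist_norm)
  have "support_fun P u \<le> - (\<delta> * r)"
    unfolding support_fun_def
  proof (rule cSUP_least[OF P_nonempty])
    fix x assume "x \<in> P"
    then have "x \<bullet> u \<le> - (\<delta> * norm x)" "\<delta> * r \<le> \<delta> * norm x"
      using d r P_subset by auto
    then show "x \<bullet> u \<le> - (\<delta> * r)" by linarith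
  qed
  moreover have "\<delta> * r > 0" using d r by simp
  ultimately show ?thesis by (simp add: depth_def)
qed

text \<open>Along a ray in the cell of \<open>u\<close>, the half-space with normal \<open>u\<close>
  is the last one to be entered, so its constraint alone decides membership in
  \<open>P\<close>.\<close>

lemma scaleR_notin_P_iff:
  assumes "u \<in> U" "v \<in> cell C U depth u" "r > 0"
  shows "r *\<^sub>R v \<in> C - P \<longleftrightarrow> r < depth u / - (v \<bullet> u)"
proof -
  have v: "v \<in> interior C" using assms cell_subset by blast
  have rv: "r *\<^sub>R v \<in> C"
    using cone_interior_scaleR[OF cone_C v assms(3)] interior_subset by blast
  have vu: "v \<bullet> u < 0" using inner_neg_interior assms v by blast
  \<comment> \<open>Multiplying by the negative number \<open>v \<bullet> w\<close> and then
    cancelling the negative number \<open>v \<bullet> u\<close> avoids quotients.\<close>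
  have "r * (v \<bullet> w) \<le> - depth w" if "r * (v \<bullet> u) \<le> - depth u" "w \<in> U" for w
  proof -
    have vw: "v \<bullet> w < 0" using inner_neg_interior that v by blast
    have 1: "depth u * (v \<bullet> w) \<le> depth w * (v \<bullet> u)"
      using assms(2) that by (auto simp: cell_def)
    have "(r * (v \<bullet> u)) * (v \<bullet> w) \<ge> (- depth u) * (v \<bullet> w)"
      using that vw by (intro mult_right_mono_neg) auto
    with 1 have 2: "(r * (v \<bullet> w)) * (v \<bullet> u) \<ge> (- depth w) * (v \<bullet> u)"
      by (simp add: mult_ac)
    show ?thesis
      using mult_strict_right_mono_neg[OF _ vu, of "- depth w" "r * (v \<bullet> w)"] 2 by force
  qed
  then have "r *\<^sub>R v \<in> P \<longleftrightarrow> r * (v \<bullet> u) \<le> - depth u"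
    using rv assms(1) by (subst P_eq) auto
  with rv vu show ?thesis by (auto simp: field_simps)
qed

lemma radial_fun_cell:
  assumes "u \<in> U" "v \<in> cell C U depth u"
  shows "radial_fun C P v = depth u / - (v \<bullet> u)"
proof -
  have "v \<bullet> u < 0" using inner_neg_interior assms cell_subset by blast
  then have pos: "0 < depth u / - (v \<bullet> u)"
    using dst_pos[OF assms(1)] by (intro divide_pos_pos) auto
  have "{r. r > 0 \<and> r *\<^sub>R v \<in> C - P} = {0<..<depth u / - (v \<bullet> u)}"
    using scaleR_notin_P_iff[OF assms]
    by (simp only: set_eq_iff mem_Collect_eq greaterThanLessThan_iff) blast
  then show ?thesis
    unfolding radial_fun_def using pos by simp
qed

lemma effective_directions_subset: "effective_directions C P \<subseteq> C"
proof
  fix v assume "v \<in> effective_directions C P"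
  then obtain x where x: "x \<in> frontier P" "v = x /\<^sub>R norm x"
    by (auto simp: effective_directions_def effective_boundary_def)
  then have "x \<in> C" using closed_P P_subset frontier_subset_eq by blast
  then show "v \<in> C" using cone_C x by (auto simp: cone_def)
qed

text \<open>The point where the ray enters \<open>P\<close> belongs to \<open>P\<close> and is a
  limit of points \<open>r *\<^sub>R v\<close> of \<open>C - P\<close> with smaller
  \<open>r\<close>, so it is on both frontiers.\<close>

lemma interior_subset_effective_directions:
  assumes "v \<in> interior C" "norm v = 1"
  shows "v \<in> effective_directions C P"
proof -
  obtain u where u: "u \<in> U" "v \<in> cell C U depth u"
    using cells_cover[of U v depth] U_nonempty assms by auto
  define \<rho> where "\<rho> = depth u / - (v \<bullet> u)"
  have "v \<bullet> u < 0" using inner_neg_interior u assms by blast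
  then have pos: "0 < \<rho>"
    unfolding \<rho>_def using dst_pos[OF u(1)] by (intro divide_pos_pos) auto
  have rP: "\<rho> *\<^sub>R v \<in> P"
    using scaleR_notin_P_iff[OF u pos] cone_interior_scaleR[OF cone_C assms(1) pos] interior_subset[of C]
    by (auto simp: \<rho>_def)
  have cl: "\<rho> *\<^sub>R v \<in> closure (C - P)"
    unfolding closure_approachable
  proof (intro allI impI)
    fix e :: real assume "e > 0"
    \<comment> \<open>The bound \<open>\<rho> / 2\<close> keeps \<open>r\<close> positive, the bound
      \<open>e / 2\<close> keeps it within \<open>e\<close> of \<open>\<rho>\<close>.\<close>
    define r where "r = \<rho> - min (e / 2) (\<rho> / 2)"
    have r: "r > 0" "r < \<rho>" "\<rho> - r < e" using pos \<open>e > 0\<close> by (auto simp: r_def min_def)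
    have "r *\<^sub>R v \<in> C - P" using scaleR_notin_P_iff[OF u r(1)] r by (auto simp: \<rho>_def)
    moreover have "dist (r *\<^sub>R v) (\<rho> *\<^sub>R v) < e"
      using r assms(2) by (simp add: dist_norm scaleR_diff_left[symmetric])
    ultimately show "\<exists>y\<in>C - P. dist y (\<rho> *\<^sub>R v) < e" by blast
  qed
  have "\<rho> *\<^sub>R v \<notin> interior (C - P)" using rP interior_subset by blast
  moreover have "\<rho> *\<^sub>R v \<notin> interior P"
    using cl closure_mono[of "C - P" "- P"] by (auto simp: interior_closure)
  ultimately have "\<rho> *\<^sub>R v \<in> effective_boundary C P"
    using cl rP closure_subset by (auto simp: effective_boundary_def frontier_def)
  then show ?thesis
    unfolding effective_directions_def using pos assms(2) by (intro image_eqI[where x = "\<rho> *\<^sub>R v"]) auto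
qed

text \<open>If \<open>u\<close> is the only maximizing normal, then near the boundary point on the
  ray \<open>P\<close> is just the half-space of \<open>u\<close>, so no other unit normal supports
  \<open>P\<close> there. The competing normal ranges over all of \<open>\<eta>\<close>, which is
  why the curvature measure is concentrated on \<open>U\<close>.\<close>

lemma mem_reverse_radial_gauss_image_iff:
  assumes u: "u \<in> U" "v \<in> cell C U depth u" and v: "norm v = 1"
    and strict: "\<And>w. w \<in> U \<Longrightarrow> w \<noteq> u \<Longrightarrow> depth u * (v \<bullet> w) \<noteq> depth w * (v \<bullet> u)"
    and \<eta>: "\<eta> \<subseteq> open_sector (polar_cone C)"
  shows "v \<in> reverse_radial_gauss_image C P \<eta> \<longleftrightarrow> u \<in> \<eta>"
proof -
  have vi: "v \<in> interior C" using u cell_subset by blast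
  have vu: "v \<bullet> u < 0" using inner_neg_interior u vi by blast
  define \<rho> where "\<rho> = depth u / - (v \<bullet> u)"
  define x where "x = \<rho> *\<^sub>R v"
  have pos: "0 < \<rho>"
    unfolding \<rho>_def using vu dst_pos[OF u(1)] by (intro divide_pos_pos) auto
  have rad: "radial_fun C P v = \<rho>" using radial_fun_cell[OF u] by (simp add: \<rho>_def)
  have xi: "x \<in> interior C" using cone_interior_scaleR[OF cone_C vi pos] by (simp add: x_def)
  have xu: "x \<bullet> u = - depth u" using vu by (simp add: x_def \<rho>_def)
  have xw: "x \<bullet> w < - depth w" if "w \<in> U" "w \<noteq> u" for w
  proof -
    have "depth u * (v \<bullet> w) < depth w * (v \<bullet> u)"
      using strict[OF that] u(2) that by (force simp: cell_def)
    then show ?thesis using vu by (simp add: x_def \<rho>_def field_simps)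
  qed
  have "u = w" if w: "w \<in> \<eta>" "x \<bullet> w = support_fun P w" for w
  proof -
    have wn: "norm w = 1" and wo: "w \<in> open_sector (polar_cone C)"
      using w \<eta> by (auto simp: open_sector_def)
    \<comment> \<open>Moving from \<open>x\<close> by a small multiple of \<open>d\<close> stays in
      \<open>P\<close> because \<open>d \<bullet> u \<le> 0\<close>. If \<open>w\<close> also
      supports \<open>P\<close> at \<open>x\<close>, the move cannot increase the inner product with
      \<open>w\<close>, so \<open>d \<bullet> w \<le> 0\<close>.\<close>
    define d where "d = w - u"
    have du: "d \<bullet> u \<le> 0"
      using Cauchy_Schwarz_ineq2[of w u] wn norm_U[OF u(1)]
      by (simp add: d_def inner_diff_left norm_eq_sqrt_inner)
    have "\<forall>\<^sub>F t in at_right 0. x + t *\<^sub>R d \<in> interior C"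
    proof -
      have "((\<lambda>t. x + t *\<^sub>R d) \<longlongrightarrow> x + 0 *\<^sub>R d) (at_right 0)"
        by (intro tendsto_intros)
      then show ?thesis using xi by (auto dest!: topological_tendstoD[where S = "interior C"])
    qed
    moreover have "\<forall>\<^sub>F t in at_right 0. \<forall>w\<in>U - {u}. (x + t *\<^sub>R d) \<bullet> w < - depth w"
    proof (rule eventually_ball_finite)
      show "finite (U - {u})" using finite_U by auto
      show "\<forall>w\<in>U - {u}. \<forall>\<^sub>F t in at_right 0. (x + t *\<^sub>R d) \<bullet> w < - depth w"
      proof
        fix w assume w: "w \<in> U - {u}"
        have "((\<lambda>t. (x + t *\<^sub>R d) \<bullet> w) \<longlongrightarrow> (x + 0 *\<^sub>R d) \<bullet> w) (at_right 0)"
          by (intro tendsto_intros)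
        then show "\<forall>\<^sub>F t in at_right 0. (x + t *\<^sub>R d) \<bullet> w < - depth w"
          using xw[of w] w by (auto dest: order_tendstoD)
      qed
    qed
    moreover have "\<forall>\<^sub>F t in at_right (0::real). t > 0"
      by (rule eventually_at_right_less)
    ultimately have "\<forall>\<^sub>F t in at_right 0. x + t *\<^sub>R d \<in> interior C \<and>
        (\<forall>w\<in>U - {u}. (x + t *\<^sub>R d) \<bullet> w < - depth w) \<and> t > 0"
      by eventually_elim auto
    then obtain t where t: "x + t *\<^sub>R d \<in> interior C"
        "\<And>w. w \<in> U - {u} \<Longrightarrow> (x + t *\<^sub>R d) \<bullet> w < - depth w" "t > 0"
      using eventually_happens[of _ "at_right (0::real)"] by force
    have "(x + t *\<^sub>R d) \<bullet> u \<le> - depth u"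
      using xu du t(3) by (simp add: inner_add_left mult_nonneg_nonpos)
    then have "x + t *\<^sub>R d \<in> P"
      using t(1,2) interior_subset[of C] by (subst P_eq) force
    then have "(x + t *\<^sub>R d) \<bullet> w \<le> x \<bullet> w"
      using le_support_fun[OF wo] w by simp
    then have "t * (d \<bullet> w) \<le> 0" by (simp add: inner_add_left)
    then have dw: "d \<bullet> w \<le> 0" using t(3) by (simp add: mult_le_0_iff)
    \<comment> \<open>For unit vectors the squared length of \<open>w - u\<close> is twice
      \<open>(w - u) \<bullet> w\<close>, so the sign just found forces
      \<open>d = 0\<close>.\<close>
    have "d \<bullet> d = (w \<bullet> w - u \<bullet> w) + (u \<bullet> u - w \<bullet> u)"
      by (simp add: d_def inner_diff_left inner_diff_right)
    also have "\<dots> = 2 * (d \<bullet> w)"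
      using wn norm_U[OF u(1)] by (simp add: d_def inner_diff_left norm_eq_1 inner_commute[of w u])
    finally have "d \<bullet> d = 0" using dw inner_ge_zero[of d] by linarith
    then show ?thesis by (simp add: d_def)
  qed
  moreover have "x \<bullet> u = support_fun P u" using xu by (simp add: depth_def)
  ultimately show ?thesis
    using interior_subset_effective_directions[OF vi v]
    unfolding reverse_radial_gauss_image_def hyperplane_def mem_Collect_eq rad x_def by blast
qed

end

section \<open>The dual curvature measures of a polytope\<close>

text \<open>The normalization changes form at \<open>q = 0\<close>. The type argument supplies the
  dimension; the factor is common to both polytopes and cancels.\<close>

definition curvature_factor :: "'a::euclidean_space itself \<Rightarrow> real \<Rightarrow> ennreal" where
  "curvature_factor _ q = (if q \<noteq> 0 then ennreal (1 / real DIM('a)) else 1)"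

lemma curvature_factor_pos_finite:
  "curvature_factor TYPE('a::euclidean_space) q \<noteq> 0" "curvature_factor TYPE('a) q < \<infinity>"
  by (auto simp: curvature_factor_def ennreal_eq_0_iff not_le)

context cone_polytope
begin

text \<open>Ties lie on finitely many hyperplanes through the origin, and the frontier of a convex
  set is null; all these sets are conic.\<close>

lemma AE_no_ties:
  "AE v in spherical_lebesgue. norm v = 1 \<and> v \<notin> frontier C \<and>
     (\<forall>u\<in>U. \<forall>w\<in>U - {u}. depth u * (v \<bullet> w) \<noteq> depth w * (v \<bullet> u))"
proof -
  have "AE v in spherical_lebesgue. norm v = 1"
    by (rule AE_I2) (simp add: space_spherical_lebesgue)
  moreover have "AE v in spherical_lebesgue. v \<notin> frontier C"
  proof (rule AE_spherical_lebesgue_not_in)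
    show "negligible (frontier C)" using convex_C by (rule negligible_convex_frontier)
    show "r *\<^sub>R x \<in> frontier C" if "r > 0" "x \<in> frontier C" for r x
    proof -
      have x: "x \<in> C" "x \<notin> interior C" using that closed_C by (auto simp: frontier_def)
      have "r *\<^sub>R x \<notin> interior C"
        using cone_interior_scaleR[OF cone_C, of "r *\<^sub>R x" "1 / r"] x that by auto
      moreover have "r *\<^sub>R x \<in> C" using cone_C x that by (auto simp: cone_def)
      ultimately show ?thesis using closed_C by (simp add: frontier_def)
    qed
  qed simp
  moreover have "AE v in spherical_lebesgue. \<forall>u\<in>U. \<forall>w\<in>U - {u}. depth u * (v \<bullet> w) \<noteq> depth w * (v \<bullet> u)"
  proof (intro eventually_ball_finite ballI)
    fix u w assume uw: "u \<in> U" "w \<in> U - {u}"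
    \<comment> \<open>Ties between \<open>u\<close> and \<open>w\<close> are the directions
      orthogonal to \<open>z\<close>. If \<open>z\<close> vanished, comparing norms would give equal
      depths and then \<open>u = w\<close>.\<close>
    define z where "z = depth u *\<^sub>R w - depth w *\<^sub>R u"
    have "z \<noteq> 0"
    proof
      assume "z = 0"
      then have *: "depth u *\<^sub>R w = depth w *\<^sub>R u" by (simp add: z_def)
      then have "norm (depth u *\<^sub>R w) = norm (depth w *\<^sub>R u)" by simp
      then have "depth u = depth w"
        using norm_U[of u] norm_U[of w] dst_pos[of u] dst_pos[of w] uw by simp
      then show False using * dst_pos[of u] uw by simp
    qed
    have "AE v in spherical_lebesgue. v \<notin> {v. z \<bullet> v = 0}"
    proof (rule AE_spherical_lebesgue_not_in)
      show "negligible {v. z \<bullet> v = 0}" using \<open>z \<noteq> 0\<close> by (intro negligible_hyperplane) auto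
      show "{v. z \<bullet> v = 0} \<in> sets borel" by (intro borel_closed closed_hyperplane)
    qed auto
    then show "AE v in spherical_lebesgue. depth u * (v \<bullet> w) \<noteq> depth w * (v \<bullet> u)"
      by eventually_elim (simp add: z_def inner_diff_left inner_diff_right inner_commute)
  qed (use finite_U in auto)
  ultimately show ?thesis by eventually_elim auto
qed

text \<open>Away from ties each interior direction lies in exactly one cell, and it belongs to the
  image exactly when the normal of that cell is in \<open>\<eta>\<close>. The integrand thus agrees
  almost everywhere with a finite sum of Borel functions, which is integrated termwise.\<close>

lemma integral_gauss_image:
  assumes \<eta>: "\<eta> \<subseteq> open_sector (polar_cone C)"
  shows "(\<integral>\<^sup>+v\<in>reverse_radial_gauss_image C P \<eta>. ennreal (radial_fun C P v powr q) \<partial>spherical_lebesgue)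
       = (\<Sum>u\<in>U. ennreal (depth u powr q) * cell_mass (cell C U depth u) q u * indicator \<eta> u)"
    (is "?L = ?R")
proof -
  let ?f = "\<lambda>u v. ennreal ((- (v \<bullet> u)) powr (- q)) * indicator (cell C U depth u) v"
  have "?L = (\<integral>\<^sup>+v. (\<Sum>u\<in>U. (ennreal (depth u powr q) * indicator \<eta> u) * ?f u v) \<partial>spherical_lebesgue)"
  proof (rule nn_integral_cong_AE, use AE_no_ties in eventually_elim)
    fix v assume v: "norm v = 1 \<and> v \<notin> frontier C \<and>
     (\<forall>u\<in>U. \<forall>w\<in>U - {u}. depth u * (v \<bullet> w) \<noteq> depth w * (v \<bullet> u))"
    show "ennreal (radial_fun C P v powr q) * indicator (reverse_radial_gauss_image C P \<eta>) v
      = (\<Sum>u\<in>U. (ennreal (depth u powr q) * indicator \<eta> u) * ?f u v)"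
    proof (cases "v \<in> interior C")
      case False
      then have "v \<notin> C" using v closed_C by (simp add: frontier_def)
      then have "v \<notin> reverse_radial_gauss_image C P \<eta>"
        using effective_directions_subset by (auto simp: reverse_radial_gauss_image_def)
      moreover have "v \<notin> cell C U depth u" for u using False cell_subset by blast
      ultimately show ?thesis by simp
    next
      case True
      obtain u where u: "u \<in> U" "v \<in> cell C U depth u"
        using cells_cover[of U v depth] U_nonempty True by auto
      have other: "v \<notin> cell C U depth w" if "w \<in> U - {u}" for w
      proof
        assume "v \<in> cell C U depth w"
        then have "depth w * (v \<bullet> u) \<le> depth u * (v \<bullet> w)" using u by (simp add: cell_def)
        moreover have "depth u * (v \<bullet> w) \<le> depth w * (v \<bullet> u)" using u that by (simp add: cell_def)
        ultimately show False using v u that by force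
      qed
      have vu: "v \<bullet> u < 0" using inner_neg_interior u True by blast
      have "(\<Sum>u\<in>U. (ennreal (depth u powr q) * indicator \<eta> u) * ?f u v)
          = (ennreal (depth u powr q) * indicator \<eta> u) * ?f u v"
        using finite_U u other by (subst sum.remove[of U u]) auto
      also have "\<dots> = ennreal (depth u powr q * (- (v \<bullet> u)) powr (- q)) * indicator \<eta> u"
        using u by (simp add: ennreal_mult mult_ac)
      also have "depth u powr q * (- (v \<bullet> u)) powr (- q) = radial_fun C P v powr q"
        unfolding radial_fun_cell[OF u] using dst_pos[OF u(1)] vu
        by (subst powr_divide) (auto simp: powr_minus divide_inverse)
      also have "indicator \<eta> u = (indicator (reverse_radial_gauss_image C P \<eta>) v :: ennreal)"
        using mem_reverse_radial_gauss_image_iff[OF u _ _ \<eta>] v u(1)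
        by (simp add: indicator_def)
      finally show ?thesis by simp
    qed
  qed
  also have "\<dots> = (\<Sum>u\<in>U. \<integral>\<^sup>+v. (ennreal (depth u powr q) * indicator \<eta> u) * ?f u v \<partial>spherical_lebesgue)"
    by (rule nn_integral_sum)
       (rule borel_measurable_times_ennreal[OF borel_measurable_const integrand_measurable[OF cell_borel]])
  also have "\<dots> = ?R"
    unfolding cell_mass_def nn_integral_cmult[OF integrand_measurable[OF cell_borel]]
    by (simp add: mult_ac)
  finally show ?thesis .
qed

lemma dual_curvature_q_eq:
  assumes "\<eta> \<subseteq> open_sector (polar_cone C)"
  shows "dual_curvature_q q C P \<eta> = curvature_factor TYPE('a) q *
      (\<Sum>u\<in>U. ennreal (depth u powr q) * cell_mass (cell C U depth u) q u * indicator \<eta> u)"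
proof (cases "q = 0")
  case False
  then show ?thesis
    using integral_gauss_image[OF assms, of q] by (simp add: dual_curvature_q_def curvature_factor_def)
next
  case True
  \<comment> \<open>As \<open>0 powr 0 = 0\<close>, replacing 1 by a zeroth power requires a nonzero
    radial function; on the image this holds almost everywhere.\<close>
  have "(\<integral>\<^sup>+v\<in>reverse_radial_gauss_image C P \<eta>. 1 \<partial>spherical_lebesgue) =
    (\<integral>\<^sup>+v\<in>reverse_radial_gauss_image C P \<eta>. ennreal (radial_fun C P v powr 0) \<partial>spherical_lebesgue)"
  proof (rule nn_integral_cong_AE, use AE_no_ties in eventually_elim)
    fix v assume v: "norm v = 1 \<and> v \<notin> frontier C \<and>
     (\<forall>u\<in>U. \<forall>w\<in>U - {u}. depth u * (v \<bullet> w) \<noteq> depth w * (v \<bullet> u))"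
    show "1 * indicator (reverse_radial_gauss_image C P \<eta>) v =
      ennreal (radial_fun C P v powr 0) * indicator (reverse_radial_gauss_image C P \<eta>) v"
    proof (cases "v \<in> interior C")
      case False
      then have "v \<notin> C" using v closed_C by (simp add: frontier_def)
      then have "v \<notin> reverse_radial_gauss_image C P \<eta>"
        using effective_directions_subset by (auto simp: reverse_radial_gauss_image_def)
      then show ?thesis by simp
    next
      case True
      then obtain u where u: "u \<in> U" "v \<in> cell C U depth u"
        using cells_cover[of U v depth] U_nonempty by auto
      have "radial_fun C P v \<noteq> 0"
        unfolding radial_fun_cell[OF u]
        using dst_pos[OF u(1)] inner_neg_interior[OF u(1) True] by simp
      then show ?thesis by simp
    qed
  qed
  then show ?thesis
    using integral_gauss_image[OF assms, of 0] True by (simp add: dual_curvature_q_def curvature_factor_def)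
qed

text \<open>\<open>measure_of\<close> returns the given set function only if it is a measure.
  Countable additivity follows from its form as a finite sum of weighted point masses.\<close>

lemma emeasure_dual_curvature_q_measure:
  assumes "\<eta> \<in> sets (restrict_space borel (open_sector (polar_cone C)))"
  shows "emeasure (dual_curvature_q_measure q C P) \<eta> = dual_curvature_q q C P \<eta>"
  unfolding dual_curvature_q_measure_def
proof (rule emeasure_measure_of_sigma[OF _ _ _ assms])
  let ?R = "restrict_space borel (open_sector (polar_cone C))"
  have sub: "A \<subseteq> open_sector (polar_cone C)" if "A \<in> sets ?R" for A
    using sets.sets_into_space[OF that] by (simp add: space_restrict_space)
  show "sigma_algebra (open_sector (polar_cone C)) (sets ?R)"
    using sets.sigma_algebra_axioms[of ?R] by (simp add: space_restrict_space)
  show "positive (sets ?R) (dual_curvature_q q C P)"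
    by (simp add: positive_def dual_curvature_q_eq)
  show "countably_additive (sets ?R) (dual_curvature_q q C P)"
    unfolding countably_additive_def
  proof (intro allI impI)
    fix A :: "nat \<Rightarrow> 'a set"
    assume A: "range A \<subseteq> sets ?R" "disjoint_family A" "\<Union> (range A) \<in> sets ?R"
    have "(\<Sum>i. dual_curvature_q q C P (A i)) = curvature_factor TYPE('a) q *
      (\<Sum>i. \<Sum>u\<in>U. ennreal (depth u powr q) * cell_mass (cell C U depth u) q u * indicator (A i) u)"
      using A(1) by (subst dual_curvature_q_eq) (auto intro!: sub)
    also have "(\<Sum>i. \<Sum>u\<in>U. ennreal (depth u powr q) * cell_mass (cell C U depth u) q u * indicator (A i) u)
       = (\<Sum>u\<in>U. \<Sum>i. ennreal (depth u powr q) * cell_mass (cell C U depth u) q u * indicator (A i) u)"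
      by (rule suminf_sum) simp
    also have "\<dots> = (\<Sum>u\<in>U. ennreal (depth u powr q) * cell_mass (cell C U depth u) q u * indicator (\<Union> (range A)) u)"
      by (simp add: suminf_indicator[OF A(2)])
    also have "curvature_factor TYPE('a) q * \<dots> = dual_curvature_q q C P (\<Union> (range A))"
      using sub[OF A(3)] by (subst dual_curvature_q_eq) auto
    finally show "(\<Sum>i. dual_curvature_q q C P (A i)) = dual_curvature_q q C P (\<Union> (range A))" .
  qed
qed

text \<open>On a singleton the density is constant, and its exponent \<open>- p\<close> joins the
  exponent \<open>q\<close> of the depth. The sign of \<open>q - p\<close> enters the argument
  here.\<close>

lemma dual_curvature_pq_singleton:
  assumes "u \<in> U"
  shows "dual_curvature_pq p q C P {u} =
    curvature_factor TYPE('a) q * (ennreal (depth u powr (q - p)) * cell_mass (cell C U depth u) q u)"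
proof -
  let ?M = "dual_curvature_q_measure q C P"
  have u: "{u} \<subseteq> open_sector (polar_cone C)" using assms U_subset by auto
  have uR: "{u} \<in> sets (restrict_space borel (open_sector (polar_cone C)))"
    unfolding sets_restrict_space using u by (intro image_eqI[where x = "{u}"]) auto
  have setsM: "{u} \<in> sets ?M"
    unfolding dual_curvature_q_measure_def
    using uR sets.space_closed[of "restrict_space borel (open_sector (polar_cone C))"]
    by (auto simp: space_restrict_space intro!: sigma_sets.Basic)
  have "dual_curvature_pq p q C P {u} = (\<integral>\<^sup>+x. ennreal (depth u powr (- p)) * indicator {u} x \<partial>?M)"
    unfolding dual_curvature_pq_def depth_def
    by (intro nn_integral_cong) (auto simp: indicator_def)
  also have "\<dots> = ennreal (depth u powr (- p)) * dual_curvature_q q C P {u}"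
    by (simp add: nn_integral_cmult_indicator[OF setsM] emeasure_dual_curvature_q_measure[OF uR])
  also have "dual_curvature_q q C P {u} =
      curvature_factor TYPE('a) q * (ennreal (depth u powr q) * cell_mass (cell C U depth u) q u)"
    unfolding dual_curvature_q_eq[OF u] using finite_U assms
    by (subst sum.remove[of U u]) auto
  also have "ennreal (depth u powr (- p)) * \<dots> =
     curvature_factor TYPE('a) q * (ennreal (depth u powr (- p) * depth u powr q) * cell_mass (cell C U depth u) q u)"
    by (simp add: ennreal_mult mult_ac)
  also have "depth u powr (- p) * depth u powr q = depth u powr (q - p)"
    by (simp add: powr_add[symmetric])
  finally show ?thesis .
qed

end

section \<open>Uniqueness\<close>

context cone_normals
begin

text \<open>This is transitivity of the comparison of \<open>a u / - (x \<bullet> u)\<close> for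
  different normals, with the negative denominators multiplied out.\<close>

lemma cell_trans:
  assumes "V \<subseteq> U" "u \<in> V" "w \<in> V" "x \<in> cell C V a u" "W \<subseteq> U" "x \<in> cell C W a w"
  shows "x \<in> cell C W a u"
proof -
  have xi: "x \<in> interior C" using assms cell_subset by blast
  have xu: "x \<bullet> u < 0" "x \<bullet> w < 0" using inner_neg_interior xi assms by blast+
  have "a u * (x \<bullet> y) \<le> a y * (x \<bullet> u)" if "y \<in> W" for y
  proof -
    have xy: "x \<bullet> y < 0" using inner_neg_interior xi assms that by blast
    have 1: "a u * (x \<bullet> w) \<le> a w * (x \<bullet> u)" using assms by (simp add: cell_def)
    have 2: "a w * (x \<bullet> y) \<le> a y * (x \<bullet> w)" using assms that by (simp add: cell_def)
    have "(a y * (x \<bullet> u)) * (x \<bullet> w) = (a y * (x \<bullet> w)) * (x \<bullet> u)" by (simp add: mult_ac)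
    also have "\<dots> \<le> (a w * (x \<bullet> y)) * (x \<bullet> u)"
      using 2 xu by (intro mult_right_mono_neg) auto
    also have "\<dots> = (a w * (x \<bullet> u)) * (x \<bullet> y)" by (simp add: mult_ac)
    also have "\<dots> \<le> (a u * (x \<bullet> w)) * (x \<bullet> y)"
      using 1 xy by (intro mult_right_mono_neg) auto
    finally have "(a y * (x \<bullet> u)) * (x \<bullet> w) \<le> (a u * (x \<bullet> y)) * (x \<bullet> w)" by (simp add: mult_ac)
    then show ?thesis
      using mult_strict_right_mono_neg[OF _ xu(2), of "a y * (x \<bullet> u)" "a u * (x \<bullet> y)"] by force
  qed
  then show ?thesis using xi by (simp add: cell_def)
qed

text \<open>The hyperplane of a normal in \<open>U\<close> may touch the polytope in a lower-dimensional face. Such a normal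
  has mass zero, so the curvature measure does not control its support number.\<close>

definition essential :: "real \<Rightarrow> ('a \<Rightarrow> real) \<Rightarrow> 'a set" where
  "essential q a = {u \<in> U. cell_mass (cell C U a u) q u \<noteq> 0}"

lemma essential_subset: "essential q a \<subseteq> U"
  by (auto simp: essential_def)

text \<open>The uncovered part is an open cone contained in the finitely many null cells; if it were
  nonempty, it would not be null.\<close>

lemma essential_cells_cover:
  assumes "U \<noteq> {}" "x \<in> interior C"
  shows "\<exists>u\<in>essential q a. x \<in> cell C U a u"
proof (rule ccontr)
  let ?O = "interior C - (\<Union>u\<in>essential q a. cell C U a u)"
  assume "\<not> ?thesis"
  then have "?O \<noteq> {}" using assms by auto
  moreover have "open ?O"
    using finite_subset[OF essential_subset finite_U] by (rule open_minus_cells)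
  ultimately have "\<not> (AE v in spherical_lebesgue. v \<notin> ?O)"
    using minus_cells_scaleR by (intro not_AE_spherical_lebesgue_open)
  moreover have "AE v in spherical_lebesgue. \<forall>u\<in>U - essential q a. v \<notin> cell C U a u"
  proof (intro eventually_ball_finite ballI)
    fix u assume "u \<in> U - essential q a"
    then have u: "u \<in> U" "cell_mass (cell C U a u) q u = 0" by (auto simp: essential_def)
    then show "AE v in spherical_lebesgue. v \<notin> cell C U a u"
      using cell_mass_eq_0_iff[OF u(1) cell_subset cell_borel] by blast
  qed (use finite_U in auto)
  then have "AE v in spherical_lebesgue. v \<notin> ?O"
  proof eventually_elim
    case (elim v)
    then show ?case using cells_cover[of U v a] assms(1) by blast
  qed
  ultimately show False by blast
qed

text \<open>At each interior point an essential normal is maximal among all of \<open>U\<close>. A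
  normal that beats every essential one beats this one, hence all of \<open>U\<close>.\<close>

lemma cell_essential:
  assumes "u \<in> essential q a"
  shows "cell C (essential q a) a u = cell C U a u"
proof (intro subset_antisym subsetI)
  fix x assume x: "x \<in> cell C (essential q a) a u"
  have uU: "U \<noteq> {}" using assms essential_subset by auto
  obtain w where w: "w \<in> essential q a" "x \<in> cell C U a w"
    using essential_cells_cover[OF uU] x cell_subset by blast
  then show "x \<in> cell C U a u"
    using cell_trans[OF essential_subset assms w(1) x] by blast
next
  fix x assume "x \<in> cell C U a u"
  then show "x \<in> cell C (essential q a) a u"
    using essential_subset by (auto simp: cell_def)
qed

lemma cell_mass_nonzero_imp_nonempty: "cell_mass D q u \<noteq> 0 \<Longrightarrow> D \<noteq> {}"
  by (auto simp: cell_mass_def)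

section \<open>Comparing two families of depths at a normal with the largest ratio\<close>

lemma max_ratio:
  fixes a b :: "'a \<Rightarrow> real"
  assumes "finite V" "V \<noteq> {}" "\<And>u. u \<in> V \<Longrightarrow> a u > 0" "\<And>u. u \<in> V \<Longrightarrow> b u > 0"
  obtains c u where "c > 0" "u \<in> V" "a u = c * b u" "\<And>w. w \<in> V \<Longrightarrow> a w \<le> c * b w"
proof -
  let ?f = "\<lambda>u. a u / b u"
  have "Max (?f ` V) \<in> ?f ` V" using assms by (intro Max_in) auto
  then obtain u where u: "u \<in> V" "?f u = Max (?f ` V)" by auto
  have "a w \<le> ?f u * b w" if "w \<in> V" for w
  proof -
    have "?f w \<le> ?f u" using u(2) assms(1) that by simp
    then show ?thesis using assms(4)[OF that] by (simp add: pos_divide_le_eq)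
  qed
  moreover have "?f u > 0" "a u = ?f u * b u" using assms(3,4)[OF u(1)] by auto
  ultimately show ?thesis using that u(1) by blast
qed

text \<open>Scaling \<open>b\<close> by \<open>c\<close> does not change its cells. Passing from
  \<open>c * b\<close> to \<open>a\<close> keeps the value at \<open>u\<close> and raises no other
  value, so the region where \<open>u\<close> is maximal can only grow.\<close>

lemma cell_mono_ratio:
  assumes "V \<subseteq> U" "u \<in> V" "a u = c * b u" "\<And>w. w \<in> V \<Longrightarrow> a w \<le> c * b w" "c > 0"
  shows "cell C V b u \<subseteq> cell C V a u"
proof
  fix x assume x: "x \<in> cell C V b u"
  then have xi: "x \<in> interior C" using cell_subset by blast
  have xu: "x \<bullet> u < 0" using inner_neg_interior xi assms by blast
  have "a u * (x \<bullet> w) \<le> a w * (x \<bullet> u)" if "w \<in> V" for w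
  proof -
    have "a u * (x \<bullet> w) = c * (b u * (x \<bullet> w))" using assms(3) by simp
    also have "\<dots> \<le> c * (b w * (x \<bullet> u))"
      using x that assms(5) by (intro mult_left_mono) (auto simp: cell_def)
    also have "\<dots> = (c * b w) * (x \<bullet> u)" by simp
    also have "\<dots> \<le> a w * (x \<bullet> u)"
      using assms(4)[OF that] xu by (intro mult_right_mono_neg) auto
    finally show ?thesis .
  qed
  then show "x \<in> cell C V a u" using xi by (simp add: cell_def)
qed

text \<open>At the normal with the largest ratio \<open>c\<close>, the mass equation gives
  \<open>c powr r * x = y\<close>, while inclusion of cells gives \<open>y \<le> x\<close>. As
  \<open>x\<close> is positive and finite and \<open>r > 0\<close>, this forces
  \<open>c \<le> 1\<close>.\<close>

lemma le_if_cell_masses_eq: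
  assumes V: "V \<subseteq> U" and "w \<in> V" and r: "r > 0"
    and a: "\<And>u. u \<in> V \<Longrightarrow> a u > 0" and b: "\<And>u. u \<in> V \<Longrightarrow> b u > 0"
    and eq: "\<And>u. u \<in> V \<Longrightarrow> ennreal (a u powr r) * cell_mass (cell C V a u) q u
        = ennreal (b u powr r) * cell_mass (cell C V b u) q u"
    and pos: "\<And>u. u \<in> V \<Longrightarrow> cell_mass (cell C V a u) q u \<noteq> 0"
  shows "a w \<le> b w"
proof -
  have fV: "finite V" "V \<noteq> {}" using V finite_U finite_subset assms(2) by auto
  obtain c u where c: "c > 0" "u \<in> V" "a u = c * b u" "\<And>w. w \<in> V \<Longrightarrow> a w \<le> c * b w"
    using max_ratio[of V a b] fV a b by blast
  define x where "x = enn2real (cell_mass (cell C V a u) q u)"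
  define y where "y = enn2real (cell_mass (cell C V b u) q u)"
  have uU: "u \<in> U" using c V by auto
  have x: "cell_mass (cell C V a u) q u = ennreal x" "x \<ge> 0"
    using cell_mass_finite[OF uU cell_subset[of V a u], of q] by (auto simp: x_def)
  have y: "cell_mass (cell C V b u) q u = ennreal y" "y \<ge> 0"
    using cell_mass_finite[OF uU cell_subset[of V b u], of q] by (auto simp: y_def)
  have x0: "x > 0" using pos[OF c(2)] x by (cases "x = 0") auto
  have "ennreal y \<le> ennreal x"
    using cell_mass_mono[OF cell_mono_ratio[where a = a and b = b and c = c, OF V c(2,3,4,1)]] x y by metis
  then have "y \<le> x" using x by simp
  have "a u powr r * x = b u powr r * y"
    using eq[OF c(2)] x y by (simp add: ennreal_mult[symmetric])
  then have "b u powr r * (c powr r * x) = b u powr r * y"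
    using c b[OF c(2)] by (simp add: powr_mult mult_ac)
  then have "c powr r * x = y" using b[OF c(2)] by simp
  with \<open>y \<le> x\<close> have "c powr r * x \<le> 1 * x" by simp
  then have "c powr r \<le> 1" using x0 by (simp only: mult_le_cancel_right_pos)
  then have "c \<le> 1"
    using r gr_one_powr[of c r] by linarith
  then have "c * b w \<le> 1 * b w"
    using b[OF assms(2)] by (intro mult_right_mono) auto
  with c(4)[OF assms(2)] show ?thesis by simp
qed

text \<open>Without powers of the depths the masses give no bound on the ratio; they only show that
  cells at maximizing normals agree up to null sets. Connectedness of the interior of the cone then
  makes every normal maximizing.\<close>

lemma proportional_if_cell_masses_eq:
  assumes V: "V \<subseteq> U" and "V \<noteq> {}"
    and a: "\<And>u. u \<in> V \<Longrightarrow> a u > 0" and b: "\<And>u. u \<in> V \<Longrightarrow> b u > 0"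
    and eq: "\<And>u. u \<in> V \<Longrightarrow> cell_mass (cell C V a u) q u = cell_mass (cell C V b u) q u"
    and pos: "\<And>u. u \<in> V \<Longrightarrow> cell_mass (cell C V a u) q u \<noteq> 0"
  shows "\<exists>c>0. \<forall>u\<in>V. a u = c * b u"
proof -
  have fV: "finite V" using V finite_U finite_subset by auto
  obtain c u0 where c: "c > 0" "u0 \<in> V" "a u0 = c * b u0" "\<And>w. w \<in> V \<Longrightarrow> a w \<le> c * b w"
    using max_ratio[of V a b] fV a b assms(2) by blast
  define W where "W = {u \<in> V. a u = c * b u}"
  have "W = V"
  proof (rule ccontr)
    assume "W \<noteq> V"
    then obtain w0 where w0: "w0 \<in> V - W" by (auto simp: W_def)
    \<comment> \<open>Where \<open>u\<close> is maximal for \<open>b\<close>, its value for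
      \<open>a\<close> is \<open>c\<close> times that maximum, whereas a normal outside
      \<open>W\<close> has an \<open>a\<close>-value strictly below \<open>c\<close> times its
      \<open>b\<close>-value.\<close>
    have disj: "x \<notin> cell C V a w" if "u \<in> W" "w \<in> V - W" "x \<in> cell C V b u" for u w x
    proof
      assume xw: "x \<in> cell C V a w"
      have u: "u \<in> V" "a u = c * b u" using that by (auto simp: W_def)
      have xu: "x \<bullet> u < 0" using inner_neg_interior u V that cell_subset by blast
      have "a w < c * b w" using c(4)[of w] that by (force simp: W_def)
      then have "c * b w * (x \<bullet> u) < a w * (x \<bullet> u)"
        using xu by (intro mult_strict_right_mono_neg) auto
      also have "\<dots> \<le> a u * (x \<bullet> w)" using xw u(1) by (simp add: cell_def)
      also have "\<dots> = c * (b u * (x \<bullet> w))" using u by simp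
      also have "\<dots> \<le> c * (b w * (x \<bullet> u))"
        using that c(1) by (intro mult_left_mono) (auto simp: cell_def)
      finally show False by simp
    qed
    \<comment> \<open>By \<open>disj\<close> no interior point lies in both removed unions, so the
      open sets \<open>G1\<close> and \<open>G2\<close> cover the interior of the cone.\<close>
    define G1 where "G1 = interior C - (\<Union>w\<in>V - W. cell C V a w)"
    define G2 where "G2 = interior C - (\<Union>u\<in>W. cell C V b u)"
    have op: "open G1" "open G2"
      using fV unfolding G1_def G2_def by (auto intro!: open_minus_cells simp: W_def)
    have "cell C V b u0 \<noteq> {}"
      using pos[OF c(2)] eq[OF c(2)] by (intro cell_mass_nonzero_imp_nonempty) auto
    then obtain x where x: "x \<in> cell C V b u0" by blast
    moreover have "u0 \<in> W" using c by (simp add: W_def)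
    ultimately have "x \<in> G1 \<inter> interior C"
      using disj[of u0] cell_subset[of V b u0] unfolding G1_def by blast
    then have ne1: "G1 \<inter> interior C \<noteq> {}" by blast
    have "cell C V a w0 \<noteq> {}"
      using pos w0 by (intro cell_mass_nonzero_imp_nonempty) auto
    then obtain x where x: "x \<in> cell C V a w0" by blast
    then have "x \<in> G2 \<inter> interior C"
      using disj[OF _ w0] cell_subset[of V a w0] unfolding G2_def by blast
    then have ne2: "G2 \<inter> interior C \<noteq> {}" by blast
    have "connected (interior C)"
      using convex_C by (intro convex_connected convex_interior)
    moreover have "interior C \<subseteq> G1 \<union> G2"
      using disj by (auto simp: G1_def G2_def)
    ultimately have "G1 \<inter> G2 \<inter> interior C \<noteq> {}"
      using connectedD[of "interior C" G1 G2] op ne1 ne2 by blast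
    then have "\<not> (AE v in spherical_lebesgue. v \<notin> G1 \<inter> G2)"
      using op minus_cells_scaleR[of _ _ V a "V - W"] minus_cells_scaleR[of _ _ V b W]
      by (intro not_AE_spherical_lebesgue_open) (auto simp only: G1_def[symmetric] G2_def[symmetric] Int_iff)
    \<comment> \<open>Equal masses make the inclusion of cells an equality up to null sets, whereas
      each point of \<open>G1 \<inter> G2\<close> lies in \<open>cell C V a u - cell C V b u\<close>
      for some \<open>u \<in> W\<close>.\<close>
    moreover have "AE v in spherical_lebesgue. \<forall>u\<in>W. v \<notin> cell C V a u - cell C V b u"
    proof (intro eventually_ball_finite ballI)
      fix u assume "u \<in> W"
      then have u: "u \<in> V" "a u = c * b u" "u \<in> U" using V by (auto simp: W_def)
      show "AE v in spherical_lebesgue. v \<notin> cell C V a u - cell C V b u"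
        using cell_mono_ratio[where a = a and b = b and c = c, OF V u(1,2) c(4,1)] eq[OF u(1)]
        by (intro AE_subset_if_cell_mass_eq[where q = q, OF u(3) _ cell_subset cell_borel cell_borel]) auto
    qed (use fV in \<open>auto simp: W_def\<close>)
    then have "AE v in spherical_lebesgue. v \<notin> G1 \<inter> G2"
    proof eventually_elim
      case (elim v)
      show ?case
        using elim cells_cover[OF V assms(2), of v a] by (auto simp: G1_def G2_def)
    qed
    ultimately show False by blast
  qed
  then show ?thesis using c(1) by (auto simp: W_def)
qed

end

section \<open>Recovering the polytope from its essential normals\<close>

context cone_polytope
begin

text \<open>At an interior point the constraint of an essential normal whose cell contains the point
  implies all other constraints. The remaining points of the cone are reached as limits of interior
  points, since \<open>P\<close> is closed.\<close>

lemma P_eq_essential: "P = {x \<in> C. \<forall>u\<in>essential q depth. x \<bullet> u \<le> - depth u}" (is "_ = ?Q")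
proof (intro subset_antisym subsetI)
  fix x assume "x \<in> P"
  then show "x \<in> ?Q" using essential_subset by (subst (asm) P_eq) auto
next
  fix x assume x: "x \<in> ?Q"
  have int: "z \<in> P" if z: "z \<in> interior C" "\<And>u. u \<in> essential q depth \<Longrightarrow> z \<bullet> u \<le> - depth u" for z
  proof -
    obtain u where u: "u \<in> essential q depth" "z \<in> cell C U depth u"
      using essential_cells_cover[OF U_nonempty z(1)] by blast
    have uU: "u \<in> U" using u essential_subset by blast
    have "z \<bullet> w \<le> - depth w" if "w \<in> U" for w
    proof -
      have "depth u * (z \<bullet> w) \<le> depth w * (z \<bullet> u)" using u(2) that by (simp add: cell_def)
      also have "\<dots> \<le> depth w * - depth u"
        using z(2)[OF u(1)] dst_pos[OF that] by (intro mult_left_mono) auto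
      finally have "depth u * (z \<bullet> w) \<le> depth u * - depth w" by (simp add: mult.commute)
      then show ?thesis using dst_pos[OF uU] by (simp only: mult_le_cancel_left_pos)
    qed
    then show ?thesis using z(1) interior_subset[of C] by (subst P_eq) auto
  qed
  obtain y where y: "y \<in> interior C" using interior_C by blast
  have "x + t *\<^sub>R y \<in> P" if "t > 0" for t
  proof (rule int)
    \<comment> \<open>This is the midpoint of \<open>x\<close> and the interior point
      \<open>t *\<^sub>R y\<close>; doubling it gives \<open>x + t *\<^sub>R y\<close>.\<close>
    have "x - (1 / 2) *\<^sub>R (x - t *\<^sub>R y) \<in> interior C"
      using x convex_C cone_interior_scaleR[OF cone_C y that]
      by (intro mem_interior_convex_shrink) auto
    then have "2 *\<^sub>R (x - (1 / 2) *\<^sub>R (x - t *\<^sub>R y)) \<in> interior C"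
      by (intro cone_interior_scaleR[OF cone_C]) auto
    then show "x + t *\<^sub>R y \<in> interior C" by (simp add: algebra_simps scaleR_2)
    fix u assume u: "u \<in> essential q depth"
    then have "y \<bullet> u < 0" using inner_neg_interior y essential_subset by blast
    then have "t * (y \<bullet> u) \<le> 0" using that by (simp add: mult_le_0_iff)
    moreover have "x \<bullet> u \<le> - depth u" using x u by auto
    ultimately show "(x + t *\<^sub>R y) \<bullet> u \<le> - depth u" by (simp add: inner_add_left)
  qed
  then have "\<forall>\<^sub>F t in at_right 0. x + t *\<^sub>R y \<in> P"
    by (auto simp: eventually_at_right_field intro: exI[of _ 1])
  moreover have "((\<lambda>t. x + t *\<^sub>R y) \<longlongrightarrow> x + 0 *\<^sub>R y) (at_right 0)"
    by (intro tendsto_intros)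
  ultimately have "x + 0 *\<^sub>R y \<in> P"
    using closed_P by (intro Lim_in_closed_set[of P _ "at_right 0"]) auto
  then show "x \<in> P" by simp
qed

end

lemma dilates_if_proportional:
  fixes C :: "'a::euclidean_space set"
  assumes "cone C" "c > 0" "\<And>u. u \<in> V \<Longrightarrow> a u = c * b u"
  shows "dilates {x \<in> C. \<forall>u\<in>V. x \<bullet> u \<le> - a u} {x \<in> C. \<forall>u\<in>V. x \<bullet> u \<le> - b u}"
  unfolding dilates_def
proof (intro exI[of _ c] conjI subset_antisym subsetI)
  fix x assume x: "x \<in> {x \<in> C. \<forall>u\<in>V. x \<bullet> u \<le> - a u}"
  have "x /\<^sub>R c \<in> C" using assms x by (auto simp: cone_def)
  moreover have "(x /\<^sub>R c) \<bullet> u \<le> - b u" if "u \<in> V" for u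
    using x that assms(2) assms(3)[OF that] by (auto simp: field_simps)
  ultimately show "x \<in> (\<lambda>x. c *\<^sub>R x) ` {x \<in> C. \<forall>u\<in>V. x \<bullet> u \<le> - b u}"
    using assms(2) by (intro image_eqI[where x = "x /\<^sub>R c"]) auto
next
  fix x assume "x \<in> (\<lambda>x. c *\<^sub>R x) ` {x \<in> C. \<forall>u\<in>V. x \<bullet> u \<le> - b u}"
  then obtain y where y: "x = c *\<^sub>R y" "y \<in> C" "\<forall>u\<in>V. y \<bullet> u \<le> - b u" by auto
  have "x \<bullet> u \<le> - a u" if "u \<in> V" for u
    using y that assms(2) assms(3)[OF that] mult_left_mono[of "y \<bullet> u" "- b u" c] by auto
  then show "x \<in> {x \<in> C. \<forall>u\<in>V. x \<bullet> u \<le> - a u}"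
    using y assms by (auto simp: cone_def)
qed (use assms in auto)

theorem theorem5p3:
  fixes C P1 P2 :: "(real ^ 'n) set" and u :: "nat \<Rightarrow> real ^ 'n" and m :: nat and p q :: real
  assumes "pointed_closed_convex_cone C"
    and "u ` {1..m} \<subseteq> open_sector (polar_cone C)"
    and "C_polytope C P1" and "P1 \<in> K_family C (u ` {1..m})"
    and "C_polytope C P2" and "P2 \<in> K_family C (u ` {1..m})"
    and "\<And>\<eta>. \<eta> \<in> sets borel \<Longrightarrow> \<eta> \<subseteq> open_sector (polar_cone C) \<Longrightarrow>
           dual_curvature_pq p q C P1 \<eta> = dual_curvature_pq p q C P2 \<eta>"
  shows "(p = q \<longrightarrow> dilates P1 P2) \<and> (p < q \<longrightarrow> P1 = P2)"
proof -
  define U where "U = u ` {1..m}"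
  interpret cone_normals C U
    using assms by unfold_locales (auto simp: U_def)
  interpret A: cone_polytope C U P1
    using assms by unfold_locales (auto simp: U_def)
  interpret B: cone_polytope C U P2
    using assms by unfold_locales (auto simp: U_def)
  \<comment> \<open>The two measures are compared only on singletons, where the common nonzero
    finite normalization cancels.\<close>
  have eq: "ennreal (A.depth w powr (q - p)) * cell_mass (cell C U A.depth w) q w
      = ennreal (B.depth w powr (q - p)) * cell_mass (cell C U B.depth w) q w" if "w \<in> U" for w
  proof -
    have "dual_curvature_pq p q C P1 {w} = dual_curvature_pq p q C P2 {w}"
      using that U_subset by (intro assms(7)) auto
    then show ?thesis
      using curvature_factor_pos_finite[where 'a = "real ^ 'n", of q]
      unfolding A.dual_curvature_pq_singleton[OF that] B.dual_curvature_pq_singleton[OF that]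
      by (auto simp: ennreal_mult_cancel_left)
  qed
  define V where "V = essential q A.depth"
  \<comment> \<open>The powers of the depths are nonzero, so the masses at a normal vanish for both
    polytopes or for neither.\<close>
  have V_B: "V = essential q B.depth"
  proof -
    have "cell_mass (cell C U A.depth w) q w = 0 \<longleftrightarrow> cell_mass (cell C U B.depth w) q w = 0" if "w \<in> U" for w
    proof -
      have "ennreal (A.depth w powr (q - p)) \<noteq> 0" "ennreal (B.depth w powr (q - p)) \<noteq> 0"
        using A.dst_pos[OF that] B.dst_pos[OF that] by auto
      then show ?thesis using eq[OF that] by (metis mult_eq_0_iff)
    qed
    then show ?thesis unfolding V_def essential_def by auto
  qed
  have VU: "V \<subseteq> U" unfolding V_def by (rule essential_subset)
  have Vne: "V \<noteq> {}"
    using essential_cells_cover[OF A.U_nonempty] interior_C unfolding V_def by blast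
  have cells: "cell C V A.depth w = cell C U A.depth w" "cell C V B.depth w = cell C U B.depth w" if "w \<in> V" for w
    using cell_essential[of w q A.depth] cell_essential[of w q B.depth] that V_B
    by (auto simp: V_def)
  have eqV: "ennreal (A.depth w powr (q - p)) * cell_mass (cell C V A.depth w) q w
      = ennreal (B.depth w powr (q - p)) * cell_mass (cell C V B.depth w) q w" if "w \<in> V" for w
    using eq cells VU that by auto
  have posA: "cell_mass (cell C V A.depth w) q w \<noteq> 0" if "w \<in> V" for w
    using that cells(1)[OF that] by (simp add: V_def essential_def)
  have posB: "cell_mass (cell C V B.depth w) q w \<noteq> 0" if "w \<in> V" for w
    using that cells(2)[OF that] by (simp add: V_B essential_def)
  have depth: "A.depth w > 0" "B.depth w > 0" if "w \<in> V" for w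
    using A.dst_pos B.dst_pos that VU by auto
  have P1: "P1 = {x \<in> C. \<forall>w\<in>V. x \<bullet> w \<le> - A.depth w}"
    unfolding V_def by (rule A.P_eq_essential)
  have P2: "P2 = {x \<in> C. \<forall>w\<in>V. x \<bullet> w \<le> - B.depth w}"
    unfolding V_B by (rule B.P_eq_essential)
  have "dilates P1 P2" if "p = q"
  proof -
    \<comment> \<open>With \<open>p = q\<close> the depth factors are zeroth powers of positive
      numbers, hence 1.\<close>
    have "cell_mass (cell C V A.depth w) q w = cell_mass (cell C V B.depth w) q w" if "w \<in> V" for w
      using eqV[OF that] depth[OF that] \<open>p = q\<close> by simp
    then obtain c where "c > 0" "\<forall>w\<in>V. A.depth w = c * B.depth w"
      using proportional_if_cell_masses_eq[where a = A.depth and b = B.depth, OF VU Vne depth(1) depth(2) _ posA] by blast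
    then have "dilates {x \<in> C. \<forall>w\<in>V. x \<bullet> w \<le> - A.depth w} {x \<in> C. \<forall>w\<in>V. x \<bullet> w \<le> - B.depth w}"
      using cone_C by (intro dilates_if_proportional) auto
    then show ?thesis using P1 P2 by metis
  qed
  moreover have "P1 = P2" if "p < q"
  proof -
    have r: "q - p > 0" using that by simp
    have "A.depth w = B.depth w" if w: "w \<in> V" for w
    proof (rule antisym)
      show "A.depth w \<le> B.depth w"
        by (rule le_if_cell_masses_eq[where a = A.depth and b = B.depth, OF VU w r depth(1) depth(2) eqV posA])
      show "B.depth w \<le> A.depth w"
        by (rule le_if_cell_masses_eq[where a = B.depth and b = A.depth, OF VU w r depth(2) depth(1) eqV[symmetric] posB])
    qed
    then have "{x \<in> C. \<forall>w\<in>V. x \<bullet> w \<le> - A.depth w} = {x \<in> C. \<forall>w\<in>V. x \<bullet> w \<le> - B.depth w}" by auto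
    then show ?thesis using P1 P2 by metis
  qed
  ultimately show ?thesis by blast
qed

end
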